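(* Let $q > 2$ be a power of a prime, let $c \in \mathbb{F}_q$, let $n \geq 2$ and let $W \subseteq \{0,1,\ldots,n\}$. Then there exists a monic irreducible polynomial $P(x)$ of degree $n$ over $\mathbb{F}_q$ such that $S_W(P) \neq c$.
   Context: For a polynomial $h(x) \in \mathbb{F}_q[x]$ of degree $n$ and a subset $W \subseteq \{0,1,\ldots,n\}$, $S_W(h) := \sum_{w \in W} [x^w] h(x)$, where $[x^w]h(x)$ denotes the coefficient of $x^w$ in $h(x)$.
   Formalization: It is additionally assumed that W contains some index w < n; otherwise the claim fails for W = ∅ with c = 0 and for W = {n} with c = 1, since then S_W(P) = c for every monic P of degree n. *)

theory Defs
  imports "HOL-Computational_Algebra.Polynomial"
begin

definition S_W :: "nat set \<Rightarrow> 'a::comm_ring_1 poly \<Rightarrow> 'a" where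
  "S_W W h = (\<Sum>w\<in>W. coeff h w)"

end

theory Submission
  imports Defs "HOL-Library.Cardinality" "HOL-Algebra.Algebraic_Closure_Type"
begin

hide_const (open) up_ring.monom up_ring.coeff Divisibility.irreducible
  Polynomials.degree Polynomials.lead_coeff

text \<open>
  Write \<open>q\<close> for the order of the field. For \<open>x\<close> in the field of order \<open>q ^ n\<close>, the function
  sending \<open>x\<close> to \<open>S_W W (\<Prod>k<n. X - x ^ (q ^ k)) - c\<close> is given by a polynomial in \<open>x\<close> whose exponents
  have only the digits 0 and 1 in base \<open>q\<close>; it is nonzero because different sets of digits never
  cancel. Its degree is at most \<open>\<Sum>i<n. q ^ i\<close>. If all monic irreducible polynomials of degree \<open>n\<close>
  had \<open>S_W W P = c\<close>, every \<open>x\<close> outside the fields of order \<open>q ^ d\<close> with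
  \<open>0 < d < n\<close> would be a root. This leaves at most \<open>2 * (\<Sum>i<n. q ^ i) < q ^ n\<close> elements in
  total, as \<open>q > 2\<close>.
\<close>

section \<open>Sums of distinct powers\<close>

text \<open>In closed form the left side is \<open>2 * (q ^ n - 1) / (q - 1)\<close>, which is at
  most \<open>q ^ n - 1\<close> once \<open>q\<close> is at least 3. The final count rests on this
  factor 2.\<close>

lemma double_sum_powers_less:
  fixes q :: nat
  assumes "q > 2"
  shows "2 * (\<Sum>i<n. q ^ i) < q ^ n"
proof (induction n)
  case (Suc n)
  have "2 * (\<Sum>i<Suc n. q ^ i) < 3 * q ^ n" using Suc by simp
  also have "\<dots> \<le> q * q ^ n" using assms by (intro mult_right_mono) auto
  finally show ?case by simp
qed simp

text \<open>Uniqueness of base-\<open>q\<close> digits: the indices below \<open>n\<close>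
  contribute less than \<open>q ^ n\<close> in total, so the sum reveals whether \<open>n\<close>
  belongs to the set, and induction handles the rest.\<close>

lemma inj_on_sum_powers:
  fixes q :: nat
  assumes "q > 2"
  shows "inj_on (\<lambda>I. \<Sum>i\<in>I. q ^ i) (Pow {..<n})"
proof (induction n)
  case 0
  show ?case by simp
next
  case (Suc n)
  have small: "(\<Sum>i\<in>I. q ^ i) < q ^ n" if "I \<subseteq> {..<n}" for I
  proof -
    have "(\<Sum>i\<in>I. q ^ i) \<le> (\<Sum>i<n. q ^ i)" using that by (intro sum_mono2) auto
    then show ?thesis using double_sum_powers_less[OF assms, of n] by linarith
  qed
  have split: "(\<Sum>i\<in>I. q ^ i) = (\<Sum>i\<in>I - {n}. q ^ i) + (if n \<in> I then q ^ n else 0)"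
    if "I \<subseteq> {..<Suc n}" for I
  proof -
    have "finite I" using that finite_subset by blast
    then show ?thesis by (cases "n \<in> I") (auto simp: sum.remove)
  qed
  show ?case
  proof (rule inj_onI)
    fix I J assume IJ: "I \<in> Pow {..<Suc n}" "J \<in> Pow {..<Suc n}"
      and eq: "(\<Sum>i\<in>I. q ^ i) = (\<Sum>i\<in>J. q ^ i)"
    have sub: "I - {n} \<subseteq> {..<n}" "J - {n} \<subseteq> {..<n}"
      using IJ by (auto simp: less_Suc_eq)
    have eq': "(\<Sum>i\<in>I - {n}. q ^ i) + (if n \<in> I then q ^ n else 0) =
        (\<Sum>i\<in>J - {n}. q ^ i) + (if n \<in> J then q ^ n else 0)"
      using eq split[of I] split[of J] IJ by simp
    have n_iff: "n \<in> I \<longleftrightarrow> n \<in> J"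
      using eq' small[OF sub(1)] small[OF sub(2)] by (cases "n \<in> I"; cases "n \<in> J") simp_all
    with eq' have "(\<Sum>i\<in>I - {n}. q ^ i) = (\<Sum>i\<in>J - {n}. q ^ i)"
      by simp
    then have "I - {n} = J - {n}"
      using inj_onD[OF Suc.IH] sub by blast
    with n_iff show "I = J" by blast
  qed
qed

section \<open>Polynomials\<close>

text \<open>The homomorphism laws are explicit hypotheses so that both \<open>to_ac\<close> and the
  Frobenius map can be plugged in.\<close>

lemma map_poly_mult_hom:
  fixes f :: "'a::comm_ring_1 \<Rightarrow> 'b::comm_ring_1"
  assumes zero: "f 0 = 0"
    and add: "\<And>x y. f (x + y) = f x + f y"
    and mult: "\<And>x y. f (x * y) = f x * f y"
  shows "map_poly f (p * r) = map_poly f p * map_poly f r"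
proof -
  have "f (\<Sum>i\<in>A. g i) = (\<Sum>i\<in>A. f (g i))" for g :: "nat \<Rightarrow> 'a" and A
    by (induction A rule: infinite_finite_induct) (simp_all add: zero add)
  then show ?thesis
    by (intro poly_eqI) (simp add: coeff_map_poly zero coeff_mult mult)
qed

lemma map_poly_prod_hom:
  fixes f :: "'a::comm_ring_1 \<Rightarrow> 'b::comm_ring_1"
  assumes zero: "f 0 = 0" and one: "f 1 = 1"
    and add: "\<And>x y. f (x + y) = f x + f y"
    and mult: "\<And>x y. f (x * y) = f x * f y"
  shows "map_poly f (\<Prod>i\<in>A. g i) = (\<Prod>i\<in>A. map_poly f (g i))"
  by (induction A rule: infinite_finite_induct)
     (simp_all add: map_poly_mult_hom zero one add mult)

text \<open>Here \<open>I\<close> collects the factors that contribute their constant term; each of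
  the others contributes X.\<close>

lemma prod_linear_expand:
  fixes a :: "nat \<Rightarrow> 'a::comm_ring_1"
  shows "(\<Prod>k<n. [:- a k, 1:]) =
    (\<Sum>I\<in>Pow {..<n}. monom ((-1) ^ card I * (\<Prod>k\<in>I. a k)) (n - card I))"
proof -
  have const: "(\<Prod>k\<in>I. [:- a k:]) = [:(-1) ^ card I * (\<Prod>k\<in>I. a k):]" if "finite I" for I
    using that by induction simp_all
  have "(\<Prod>k<n. [:- a k, 1:]) = (\<Prod>k<n. [:- a k:] + monom 1 1)"
    by (simp add: monom_altdef)
  also have "\<dots> = (\<Sum>I\<in>Pow {..<n}. (\<Prod>k\<in>I. [:- a k:]) * (\<Prod>k\<in>{..<n} - I. monom 1 1))"
    by (rule prod_add) simp
  also have "\<dots> = (\<Sum>I\<in>Pow {..<n}. monom ((-1) ^ card I * (\<Prod>k\<in>I. a k)) (n - card I))"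
  proof (rule sum.cong)
    fix I assume "I \<in> Pow {..<n}"
    then have "finite I" "card ({..<n} - I) = n - card I"
      by (auto simp: card_Diff_subset finite_subset)
    then show "(\<Prod>k\<in>I. [:- a k:]) * (\<Prod>k\<in>{..<n} - I. monom 1 1) =
        monom ((-1) ^ card I * (\<Prod>k\<in>I. a k)) (n - card I)"
      by (simp add: const monom_power smult_monom)
  qed simp
  finally show ?thesis .
qed

text \<open>The fixed points are the roots of X^N - X, which splits into linear factors. Its
  derivative is -1, so no root is repeated and there are exactly \<open>N\<close> of them.\<close>

lemma card_fixed_points_power:
  assumes char: "of_nat N = (0 :: 'b::alg_closed_field)" and N: "N > 1"
  shows "finite {x :: 'b. x ^ N = x}" and "card {x :: 'b. x ^ N = x} = N"
proof -
  define p :: "'b poly" where "p = monom 1 N - monom 1 1"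
  have deg: "degree p = N"
    unfolding p_def using N by (simp add: diff_conv_add_uminus degree_add_eq_left degree_monom_eq
        del: add_uminus_conv_diff)
  then have "p \<noteq> 0" using N by auto
  have roots: "{x. x ^ N = x} = {x. poly p x = 0}"
    by (auto simp: p_def poly_monom)
  have deriv: "pderiv p = -1"
    using char by (simp add: p_def pderiv_diff pderiv_monom)
  have lead: "lead_coeff p = 1"
    unfolding deg using N by (simp add: p_def)
  obtain A where A: "size A = degree p" "p = (\<Prod>x\<in>#A. [:-x, 1:])"
    using alg_closed_imp_factorization[OF \<open>p \<noteq> 0\<close>] lead by auto
  have "count A a \<le> 1" for a
  proof (rule ccontr)
    assume "\<not> count A a \<le> 1"
    then have "replicate_mset 2 a \<subseteq># A"
      by (simp add: count_le_replicate_mset_subset_eq[symmetric])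
    then obtain B where "A = replicate_mset 2 a + B"
      by (auto simp: mset_subset_eq_exists_conv)
    then have "p = [:-a, 1:] * ([:-a, 1:] * (\<Prod>x\<in>#B. [:-x, 1:]))"
      using A(2) by (simp add: numeral_2_eq_2)
    then obtain r where "p = [:-a, 1:] * ([:-a, 1:] * r)" by blast
    then have "poly (pderiv p) a = 0"
      by (simp only: pderiv_mult poly_add poly_mult) simp
    then show False by (simp add: deriv)
  qed
  then have "count A a = count (mset_set (set_mset A)) a" for a
    by (cases "a \<in># A") (simp_all add: not_in_iff le_antisym Suc_le_eq)
  then have "A = mset_set (set_mset A)" by (rule multiset_eqI)
  then have "size A = card (set_mset A)" by (metis size_mset_set)
  moreover have "{x. poly p x = 0} = set_mset A"
    by (subst A(2)) (auto simp: poly_prod_mset prod_mset_zero_iff)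
  ultimately show "finite {x :: 'b. x ^ N = x}" "card {x :: 'b. x ^ N = x} = N"
    using A(1) deg roots by simp_all
qed

section \<open>The Frobenius map on the algebraic closure of a finite field\<close>

lemma two_le_card_field: "2 \<le> CARD('a::{finite,field})"
  using card_mono[of UNIV "{0, 1 :: 'a}"] by simp

text \<open>Translation by 1 permutes the field, so it leaves the sum of all elements
  unchanged.\<close>

lemma of_nat_card_eq_0: "of_nat CARD('a) = (0 :: 'a::{finite,field})"
proof -
  have "(\<Sum>x\<in>(UNIV :: 'a set). x + 1) = (\<Sum>x\<in>UNIV. x)"
    by (rule sum.reindex_bij_witness[of _ "\<lambda>x. x - 1" "\<lambda>x. x + 1"]) auto
  then show ?thesis by (simp add: sum.distrib)
qed

lemma power_card_field: "x ^ CARD('a) = (x :: 'a::{finite,field})"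
proof (cases "x = 0")
  case True
  then show ?thesis using two_le_card_field[where 'a = 'a] by simp
next
  case False
  define U where "U = UNIV - {0 :: 'a}"
  \<comment> \<open>Multiplication by \<open>x\<close> permutes the nonzero elements, hence
    preserves their product.\<close>
  have "x ^ card U * \<Prod>U = (\<Prod>y\<in>U. x * y)"
    by (simp add: prod.distrib)
  also have "\<dots> = \<Prod>U"
    by (rule prod.reindex_bij_witness[of _ "\<lambda>y. y / x" "\<lambda>y. x * y"])
       (use False in \<open>auto simp: U_def\<close>)
  finally have "x ^ card U = 1"
    by (simp add: U_def)
  moreover have "CARD('a) = Suc (card U)"
    using two_le_card_field[where 'a = 'a] by (simp add: U_def card_Diff_subset)
  ultimately show ?thesis by simp
qed

lemma power_card_to_ac: "to_ac x ^ CARD('a) = to_ac (x :: 'a::{finite,field})"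
  by (metis power_card_field to_ac_power)

text \<open>No binomial coefficients are needed: (1 + X)^q and X^q + 1 are monic of degree q and
  agree at the q elements of the base field, so they coincide. Evaluating at \<open>x / y\<close>
  and clearing denominators gives the claim.\<close>

lemma frobenius_add:
  fixes x y :: "'a::{finite,field} alg_closure"
  shows "(x + y) ^ CARD('a) = x ^ CARD('a) + y ^ CARD('a)"
proof (cases "y = 0")
  case True
  then show ?thesis using two_le_card_field[where 'a = 'a] by simp
next
  case False
  define q where "q = CARD('a)"
  have q: "q \<ge> 2" unfolding q_def by (rule two_le_card_field)
  have "[:1, 1 :: 'a alg_closure:] ^ q = monom 1 q + 1"
  proof (rule poly_eqI_degree_lead_coeff[where A = "range to_ac" and n = q])
    show "coeff ([:1, 1 :: 'a alg_closure:] ^ q) q = coeff (monom 1 q + 1) q"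
      using lead_coeff_power[of "[:1, 1 :: 'a alg_closure:]" q] q
      by (simp add: degree_power_eq)
    show "card (range (to_ac :: 'a \<Rightarrow> _)) \<ge> q"
      by (simp add: q_def card_image inj_to_ac)
    show "degree ([:1, 1 :: 'a alg_closure:] ^ q) \<le> q"
      by (simp add: degree_power_eq)
    show "degree (monom (1 :: 'a alg_closure) q + 1) \<le> q"
      by (intro degree_add_le) (auto simp: degree_monom_le)
    fix z :: "'a alg_closure" assume "z \<in> range to_ac"
    then obtain a where z: "z = to_ac a" by auto
    have "poly ([:1, 1:] ^ q) z = to_ac (1 + a) ^ q" by (simp add: z)
    also have "\<dots> = z ^ q + 1"
      unfolding q_def z power_card_to_ac by simp
    finally show "poly ([:1, 1:] ^ q) z = poly (monom 1 q + 1) z"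
      by (simp add: poly_monom)
  qed
  then have "poly ([:1, 1:] ^ q) (x / y) = poly (monom 1 q + 1) (x / y)" by simp
  then have "(1 + x / y) ^ q = (x / y) ^ q + 1" by (simp add: poly_monom)
  moreover have "x + y = (1 + x / y) * y" using False by (simp add: field_simps)
  ultimately have "(x + y) ^ q = ((x / y) ^ q + 1) * y ^ q" by (simp add: power_mult_distrib)
  then show ?thesis using False by (simp add: q_def field_simps power_divide)
qed

lemma frobenius_uminus:
  fixes x :: "'a::{finite,field} alg_closure"
  shows "(- x) ^ CARD('a) = - (x ^ CARD('a))"
  using frobenius_add[of x "- x"] two_le_card_field[where 'a = 'a]
  by (simp add: power_0_left minus_unique)

text \<open>The base field already supplies \<open>CARD('a)\<close> fixed points, and there are no
  more than that.\<close>

lemma frobenius_fixed_imp_range_to_ac: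
  fixes x :: "'a::{finite,field} alg_closure"
  assumes "x ^ CARD('a) = x"
  shows "x \<in> range to_ac"
proof -
  let ?R = "{x :: 'a alg_closure. x ^ CARD('a) = x}"
  have "of_nat CARD('a) = (0 :: 'a alg_closure)"
    using of_nat_card_eq_0[where 'a = 'a] by (metis to_ac_0 to_ac_of_nat)
  then have R: "finite ?R" "card ?R = CARD('a)"
    using card_fixed_points_power[of "CARD('a)", where 'b = "'a alg_closure"]
      two_le_card_field[where 'a = 'a] by simp_all
  have "range to_ac = ?R"
    by (rule card_subset_eq) (use R in \<open>auto simp: power_card_to_ac card_image inj_to_ac\<close>)
  then show ?thesis using assms by blast
qed

lemma poly_map_to_ac_frobenius:
  fixes g :: "'a::{finite,field} poly"
  shows "poly (map_poly to_ac g) (x ^ CARD('a)) = poly (map_poly to_ac g) x ^ CARD('a)"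
proof (induction g)
  case 0
  then show ?case using two_le_card_field[where 'a = 'a] by simp
next
  case (pCons a g)
  then show ?case
    by (simp add: map_poly_pCons frobenius_add power_mult_distrib power_card_to_ac)
qed

lemma root_frobenius_power:
  fixes g :: "'a::{finite,field} poly"
  assumes "poly (map_poly to_ac g) x = 0"
  shows "poly (map_poly to_ac g) (x ^ (CARD('a) ^ k)) = 0"
proof (induction k)
  case 0
  then show ?case using assms by simp
next
  case (Suc k)
  have "x ^ (CARD('a) ^ Suc k) = (x ^ (CARD('a) ^ k)) ^ CARD('a)"
    by (simp add: mult.commute flip: power_mult)
  then show ?case
    using Suc two_le_card_field[where 'a = 'a] by (simp add: poly_map_to_ac_frobenius)
qed

text \<open>Frobenius permutes the conjugates of \<open>x\<close> cyclically, so their product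
  polynomial has coefficients in the base field. A nonzero polynomial over the base field vanishing
  at \<open>x\<close> vanishes at all \<open>n\<close> distinct conjugates, so no factor of smaller
  degree can have \<open>x\<close> as a root.\<close>

lemma irreducible_conjugate_product:
  fixes x :: "'a::{finite,field} alg_closure"
  assumes n: "n > 0"
    and fixed: "x ^ (CARD('a) ^ n) = x"
    and moved: "\<And>d. 0 < d \<Longrightarrow> d < n \<Longrightarrow> x ^ (CARD('a) ^ d) \<noteq> x"
  obtains P :: "'a poly"
  where "map_poly to_ac P = (\<Prod>k<n. [:- (x ^ (CARD('a) ^ k)), 1:])"
    and "lead_coeff P = 1" and "degree P = n" and "irreducible P"
proof -
  define q where "q = CARD('a)"
  have q: "q \<ge> 2" unfolding q_def by (rule two_le_card_field)
  define Q where "Q = (\<Prod>k<n. [:- (x ^ (q ^ k)), 1:])"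
  \<comment> \<open>\<open>of_ac\<close> inverts \<open>to_ac\<close> only on the range of
    \<open>to_ac\<close>, so the coefficients of \<open>Q\<close> must still be shown to lie
    there.\<close>
  define P where "P = map_poly of_ac Q"
  have Suc_pow: "(x ^ (q ^ k)) ^ q = x ^ (q ^ Suc k)" for k
    by (simp add: mult.commute flip: power_mult)
  have "map_poly (\<lambda>z. z ^ q) Q = (\<Prod>k<n. map_poly (\<lambda>z. z ^ q) [:- (x ^ (q ^ k)), 1:])"
    unfolding Q_def q_def using q
    by (intro map_poly_prod_hom) (auto simp: frobenius_add power_mult_distrib q_def)
  also have "\<dots> = (\<Prod>k<n. [:- (x ^ (q ^ Suc k)), 1:])"
    by (intro prod.cong refl, subst Suc_pow[symmetric])
       (use q in \<open>simp add: map_poly_pCons q_def frobenius_uminus\<close>)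
  \<comment> \<open>The shifted product loses the factor for \<open>k = 0\<close> and gains one for
    \<open>k = n\<close>; these agree because \<open>x\<close> is fixed by the \<open>n\<close>-th
    iterate.\<close>
  also have "\<dots> = Q"
  proof -
    obtain m where m: "n = Suc m" using n by (cases n) auto
    have "(\<Prod>k<Suc m. [:- (x ^ (q ^ k)), 1:]) =
        [:- (x ^ (q ^ 0)), 1:] * (\<Prod>k<m. [:- (x ^ (q ^ Suc k)), 1:])"
      by (rule prod.lessThan_Suc_shift)
    moreover have "x ^ (q ^ Suc m) = x" using fixed by (simp add: q_def m)
    ultimately show ?thesis unfolding Q_def m by (simp add: mult.commute)
  qed
  finally have Q_fixed: "map_poly (\<lambda>z. z ^ q) Q = Q" .
  have "coeff Q i \<in> range to_ac" for i
  proof (rule frobenius_fixed_imp_range_to_ac)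
    have "coeff (map_poly (\<lambda>z. z ^ q) Q) i = coeff Q i ^ q"
      using q by (simp add: coeff_map_poly)
    then show "coeff Q i ^ CARD('a) = coeff Q i" using Q_fixed by (simp add: q_def)
  qed
  then have P: "map_poly to_ac P = Q"
    by (intro poly_eqI) (simp add: P_def coeff_map_poly to_ac_of_ac)
  have degQ: "degree Q = n"
    unfolding Q_def by (subst degree_prod_eq_sum_degree) auto
  have deg_map: "degree (map_poly to_ac g) = degree g" for g :: "'a poly"
    by (rule degree_map_poly) simp
  have degP: "degree P = n" using degQ deg_map[of P] P by simp
  have "to_ac (lead_coeff P) = lead_coeff Q"
    using P degQ degP by (metis coeff_map_poly to_ac_0)
  also have "\<dots> = 1" unfolding Q_def by (simp add: lead_coeff_prod)
  finally have "to_ac (lead_coeff P) = to_ac 1" by simp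
  then have lead: "lead_coeff P = 1" by (simp only: to_ac_eq_iff)
  have inj: "inj_on (\<lambda>k. x ^ (q ^ k)) {..<n}"
  proof (rule linorder_inj_onI)
    fix i j assume ij: "i < j" "j \<in> {..<n}"
    show "x ^ (q ^ i) \<noteq> x ^ (q ^ j)"
    proof
      assume "x ^ (q ^ i) = x ^ (q ^ j)"
      \<comment> \<open>Applying Frobenius \<open>n - j\<close> more times turns the right side into
        \<open>x\<close>, so \<open>x\<close> would already return after
        \<open>i + (n - j) < n\<close> iterations.\<close>
      then have "(x ^ (q ^ i)) ^ (q ^ (n - j)) = (x ^ (q ^ j)) ^ (q ^ (n - j))" by simp
      then have "x ^ (q ^ (i + (n - j))) = x ^ (q ^ n)"
        using ij by (simp flip: power_mult power_add)
      moreover have "0 < i + (n - j)" "i + (n - j) < n" using ij by auto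
      ultimately show False using moved fixed unfolding q_def by metis
    qed
  qed auto
  have deg_ge: "n \<le> degree g" if "g \<noteq> 0" "poly (map_poly to_ac g) x = 0" for g :: "'a poly"
  proof -
    have nz: "map_poly to_ac g \<noteq> 0" using that(1) by (simp add: map_poly_eq_0_iff)
    have "n = card ((\<lambda>k. x ^ (q ^ k)) ` {..<n})" by (simp add: card_image inj)
    also have "\<dots> \<le> card {z. poly (map_poly to_ac g) z = 0}"
      by (intro card_mono poly_roots_finite nz)
         (use root_frobenius_power[OF that(2)] in \<open>auto simp: q_def\<close>)
    also have "\<dots> \<le> degree g" using card_poly_roots_bound[OF nz] by (simp add: deg_map)
    finally show ?thesis .
  qed
  have "irreducible P"
  proof (rule Factorial_Ring.irreducibleI)
    show "P \<noteq> 0" using degP n by auto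
    show "\<not> is_unit P" using degP n by (auto simp: is_unit_iff_degree \<open>P \<noteq> 0\<close>)
    fix a b assume ab: "P = a * b"
    then have nz: "a \<noteq> 0" "b \<noteq> 0" using \<open>P \<noteq> 0\<close> by auto
    have deg: "degree a + degree b = n" using degP ab nz by (simp add: degree_mult_eq)
    have "poly Q x = 0" unfolding Q_def poly_prod
      using n by (auto intro!: bexI[of _ 0])
    moreover have "Q = map_poly to_ac a * map_poly to_ac b"
      using P ab by (simp add: map_poly_mult_hom)
    ultimately have "poly (map_poly to_ac a) x = 0 \<or> poly (map_poly to_ac b) x = 0" by simp
    then have "n \<le> degree a \<or> n \<le> degree b" using deg_ge nz by blast
    then have "degree b = 0 \<or> degree a = 0" using deg by linarith
    then show "is_unit a \<or> is_unit b" using nz by (auto simp: is_unit_iff_degree)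
  qed
  then show thesis using that[of P] P lead degP by (simp add: Q_def q_def)
qed

section \<open>Coefficient sums of conjugate products\<close>

text \<open>The variable stands for \<open>x\<close>, not for the variable of the conjugate product:
  that product has terms of degree \<open>n - card I\<close>, and only those with degree in
  \<open>W\<close> are kept.\<close>

definition coeff_sum_poly :: "nat set \<Rightarrow> nat \<Rightarrow> nat \<Rightarrow> 'a::comm_ring_1 poly" where
  "coeff_sum_poly W n q =
    (\<Sum>I \<in> {I \<in> Pow {..<n}. n - card I \<in> W}. monom ((-1) ^ card I) (\<Sum>i\<in>I. q ^ i))"

lemma S_W_conjugate_product:
  fixes x :: "'a::comm_ring_1"
  assumes "finite W"
  shows "S_W W (\<Prod>k<n. [:- (x ^ (q ^ k)), 1:]) = poly (coeff_sum_poly W n q) x"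
proof -
  have "S_W W (\<Prod>k<n. [:- (x ^ (q ^ k)), 1:]) =
      (\<Sum>w\<in>W. \<Sum>I\<in>Pow {..<n}. if n - card I = w then (-1) ^ card I * x ^ (\<Sum>i\<in>I. q ^ i) else 0)"
    by (simp add: S_W_def prod_linear_expand coeff_sum flip: power_sum)
  also have "\<dots> = (\<Sum>I\<in>Pow {..<n}. if n - card I \<in> W then (-1) ^ card I * x ^ (\<Sum>i\<in>I. q ^ i) else 0)"
    by (subst sum.swap) (simp add: assms)
  also have "\<dots> = poly (coeff_sum_poly W n q) x"
    by (simp add: coeff_sum_poly_def poly_sum poly_monom sum.If_cases Int_def)
  finally show ?thesis .
qed

lemma degree_coeff_sum_poly_le: "degree (coeff_sum_poly W n q) \<le> (\<Sum>i<n. q ^ i)"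
  unfolding coeff_sum_poly_def
proof (rule degree_sum_le)
  fix I assume "I \<in> {I \<in> Pow {..<n}. n - card I \<in> W}"
  then have "(\<Sum>i\<in>I. q ^ i) \<le> (\<Sum>i<n. q ^ i)" by (intro sum_mono2) auto
  then show "degree (monom ((-1) ^ card I) (\<Sum>i\<in>I. q ^ i)) \<le> (\<Sum>i<n. q ^ i)"
    using degree_monom_le le_trans by blast
qed simp

text \<open>An index below \<open>n\<close> yields a term of positive degree, which nothing cancels.
  For \<open>W\<close> contained in \<open>{n}\<close> with \<open>n > 0\<close> the polynomial
  would be the constant 0 or 1.\<close>

lemma coeff_sum_poly_neq_const:
  assumes "q > 2" and w: "w \<in> W" "w < n"
  shows "coeff_sum_poly W n q \<noteq> [:c :: 'a::comm_ring_1:]"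
proof -
  define e where "e = (\<lambda>I. \<Sum>i\<in>I. q ^ i)"
  let ?S = "{I \<in> Pow {..<n}. n - card I \<in> W}"
  \<comment> \<open>Any set of \<open>n - w\<close> indices contributes to the coefficient at
    \<open>w\<close>. This one is nonempty since \<open>w < n\<close>, and it contains 0, which
    makes \<open>e J\<close> positive.\<close>
  define J where "J = {..<n - w}"
  have J: "J \<in> ?S" using w by (auto simp: J_def)
  have inj: "inj_on e (Pow {..<n})" unfolding e_def by (rule inj_on_sum_powers) fact
  have "coeff (coeff_sum_poly W n q :: 'a poly) (e J) =
      (\<Sum>I\<in>?S. if e I = e J then (-1) ^ card I else 0)"
    by (simp add: coeff_sum_poly_def coeff_sum e_def)
  also have "\<dots> = (\<Sum>I\<in>?S. if I = J then (-1) ^ card J else 0)"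
    using inj_onD[OF inj] J by (intro sum.cong refl) auto
  also have "\<dots> = (-1) ^ card J" using J by simp
  finally have "coeff (coeff_sum_poly W n q :: 'a poly) (e J) = (-1) ^ card J" .
  moreover have "(-1 :: 'a) ^ card J \<noteq> 0"
    by (cases "even (card J)") simp_all
  moreover have "e J > 0"
    unfolding e_def by (rule sum_pos2[where i = 0]) (use w in \<open>auto simp: J_def\<close>)
  then have "coeff [:c:] (e J) = 0" by (simp add: coeff_eq_0)
  ultimately show ?thesis by metis
qed

section \<open>Counting the elements of the field of order \<open>q ^ n\<close>\<close>

theorem theorem1p4:
  fixes c :: "'a::{finite,field}" and n :: nat and W :: "nat set"
  assumes "card (UNIV :: 'a set) > 2"
    and "n \<ge> 2"
    and "W \<subseteq> {0..n}"
    and "\<exists>w\<in>W. w < n"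
  shows "\<exists>P :: 'a poly. lead_coeff P = 1 \<and> irreducible P \<and> degree P = n \<and> S_W W P \<noteq> c"
proof (rule ccontr)
  assume contra: "\<not> ?thesis"
  define q where "q = CARD('a)"
  have q: "q > 2" using assms(1) by (simp add: q_def)
  have W: "finite W" using assms(3) finite_subset by blast
  \<comment> \<open>For \<open>d > 0\<close> this is the subfield of order \<open>q ^ d\<close> of
    the algebraic closure.\<close>
  define F where "F d = {x :: 'a alg_closure. x ^ (q ^ d) = x}" for d
  have F: "finite (F d)" "card (F d) = q ^ d" if "d > 0" for d
  proof -
    have "of_nat q = (0 :: 'a alg_closure)"
      unfolding q_def using of_nat_card_eq_0[where 'a = 'a] by (metis to_ac_0 to_ac_of_nat)
    then have "of_nat (q ^ d) = (0 :: 'a alg_closure)" using that by simp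
    moreover have "1 < q ^ d" using q that by (intro one_less_power) auto
    ultimately show "finite (F d)" "card (F d) = q ^ d"
      unfolding F_def by (rule card_fixed_points_power)+
  qed
  define G where "G = coeff_sum_poly W n q - [:to_ac c:]"
  have "G \<noteq> 0"
    using coeff_sum_poly_neq_const[OF q] assms(4) by (auto simp: G_def)
  have degG: "degree G \<le> (\<Sum>i<n. q ^ i)"
    unfolding G_def by (intro degree_diff_le degree_coeff_sum_poly_le) simp
  \<comment> \<open>An element of \<open>F n\<close> outside all smaller \<open>F d\<close> gives a
    monic irreducible polynomial of degree \<open>n\<close>, whose coefficient sum is
    \<open>c\<close> by assumption. Taking all \<open>d < n\<close>, not only divisors of
    \<open>n\<close>, is wasteful but affordable.\<close>
  have "F n \<subseteq> {x. poly G x = 0} \<union> (\<Union>d\<in>{1..<n}. F d)"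
  proof
    fix x assume x: "x \<in> F n"
    show "x \<in> {x. poly G x = 0} \<union> (\<Union>d\<in>{1..<n}. F d)"
    proof (cases "x \<in> (\<Union>d\<in>{1..<n}. F d)")
      case False
      obtain P :: "'a poly" where P: "map_poly to_ac P = (\<Prod>k<n. [:- (x ^ (q ^ k)), 1:])"
          "lead_coeff P = 1" "degree P = n" "irreducible P"
        using irreducible_conjugate_product[of n x] x False assms(2)
        by (auto simp: F_def q_def)
      have "poly (coeff_sum_poly W n q) x = S_W W (map_poly to_ac P)"
        by (simp add: S_W_conjugate_product[OF W] P(1))
      also have "\<dots> = to_ac (S_W W P)"
        by (simp add: S_W_def coeff_map_poly to_ac_sum)
      also have "S_W W P = c" using contra P by blast
      finally show ?thesis by (simp add: G_def)
    qed simp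
  qed
  then have "card (F n) \<le> card ({x. poly G x = 0} \<union> (\<Union>d\<in>{1..<n}. F d))"
    by (intro card_mono) (auto simp: F poly_roots_finite[OF \<open>G \<noteq> 0\<close>])
  also have "\<dots> \<le> card {x. poly G x = 0} + card (\<Union>d\<in>{1..<n}. F d)"
    by (rule card_Un_le)
  also have "\<dots> \<le> degree G + (\<Sum>d\<in>{1..<n}. card (F d))"
    by (intro add_mono card_poly_roots_bound card_UN_le) (use \<open>G \<noteq> 0\<close> in auto)
  also have "(\<Sum>d\<in>{1..<n}. card (F d)) = (\<Sum>d\<in>{1..<n}. q ^ d)"
    by (intro sum.cong refl F(2)) auto
  \<comment> \<open>Adding the term for \<open>d = 0\<close> makes this bound equal to the one on
    the degree of \<open>G\<close>.\<close>
  also have "\<dots> \<le> (\<Sum>d<n. q ^ d)"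
    by (intro sum_mono2) auto
  also have "degree G + (\<Sum>d<n. q ^ d) \<le> 2 * (\<Sum>d<n. q ^ d)"
    using degG by simp
  also have "\<dots> < q ^ n" using q by (rule double_sum_powers_less)
  finally show False using F(2)[of n] assms(2) by simp
qed

end
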